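(* Let $A,B\in\mathbb{R}^{n\times n}$. The matrix $A+BD$ is nonsingular for every $D\in[-I_n,I_n]$ if and only if the system $|A^Tx|\leq|B^Tx|$, $x\in\mathbb{R}^n$, has only the trivial solution $x=0$.
   Context: Inequalities and absolute values of vectors and matrices are understood entrywise. $I_n$ is the $n\times n$ identity matrix. $[-I_n,I_n]$ denotes the set of matrices $D\in\mathbb{R}^{n\times n}$ with $-I_n\leq D\leq I_n$ entrywise, i.e. the diagonal matrices with all diagonal entries in $[-1,1]$. *)

theory Defs
  imports "HOL-Analysis.Analysis"
begin

text \<open>On \<open>real ^ 'n\<close> and \<open>real ^ 'n ^ 'n\<close> the library order and absolute value are
  entrywise, so the order interval \<open>{- mat 1 .. mat 1}\<close> is exactly the set of diagonal
  matrices with diagonal entries in \<open>[-1, 1]\<close>.\<close>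

lemma abs_le_abs_vec_iff:
  fixes u v :: "real ^ 'n"
  shows "\<bar>u\<bar> \<le> \<bar>v\<bar> \<longleftrightarrow> (\<forall>i. \<bar>u $ i\<bar> \<le> \<bar>v $ i\<bar>)"
  by (simp add: less_eq_vec_def abs_vec_def)

lemma mem_unit_interval_iff:
  fixes D :: "real ^ 'n ^ 'n"
  shows "D \<in> {- mat 1 .. mat 1} \<longleftrightarrow>
    (\<forall>i j. i \<noteq> j \<longrightarrow> D $ i $ j = 0) \<and> (\<forall>i. - 1 \<le> D $ i $ i \<and> D $ i $ i \<le> 1)"
  unfolding atLeastAtMost_iff less_eq_vec_def mat_def
  by (simp, metis (no_types, lifting) antisym_conv neg_equal_0_iff_equal minus_zero order_refl)

end

theory Submission
  imports Defs
begin

text \<open>Nonsingularity of \<open>A + B ** D\<close> can be tested on its transpose, which for diagonal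
  \<open>D\<close> is \<open>transpose A + D ** transpose B\<close>. So some \<open>A + B ** D\<close> is singular exactly when
  some nonzero \<open>x\<close> satisfies \<open>transpose A *v x + D *v (transpose B *v x) = 0\<close>. Transposing has
  moved \<open>D\<close> to the outside, where it rescales the coordinates of \<open>transpose B *v x\<close>
  independently, by factors from \<open>[-1, 1]\<close>. By \<open>abs_le_iff_diagonal_annihilates\<close>, a suitable
  \<open>D\<close> exists for a given \<open>x\<close> exactly when \<open>x\<close> solves the absolute value inequality.\<close>

lemma unit_interval_mult_vec_nth:
  fixes D :: "real ^ 'n ^ 'n"
  assumes "D \<in> {- mat 1 .. mat 1}"
  shows "(D *v v) $ i = D $ i $ i * v $ i"
proof -
  have "(D *v v) $ i = (\<Sum>j\<in>UNIV. D $ i $ j * v $ j)"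
    by (simp add: matrix_vector_mult_def)
  also have "\<dots> = (\<Sum>j\<in>UNIV. if j = i then D $ i $ i * v $ i else 0)"
    using assms unfolding mem_unit_interval_iff by (intro sum.cong) auto
  finally show ?thesis by simp
qed

lemma transpose_unit_interval:
  fixes D :: "real ^ 'n ^ 'n"
  assumes "D \<in> {- mat 1 .. mat 1}"
  shows "transpose D = D"
proof -
  have "D $ j $ i = D $ i $ j" for i j
    using assms unfolding mem_unit_interval_iff by (cases "i = j") auto
  then show ?thesis
    by (simp add: transpose_def vec_eq_iff)
qed

text \<open>The coordinates decouple: \<open>\<bar>a\<bar> \<le> \<bar>b\<bar>\<close> for reals means that \<open>a = - (d * b)\<close> for
  some \<open>d\<close> with \<open>\<bar>d\<bar> \<le> 1\<close>, namely \<open>d = - a / b\<close>.\<close>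

lemma abs_le_iff_diagonal_annihilates:
  fixes u v :: "real ^ 'n"
  shows "\<bar>u\<bar> \<le> \<bar>v\<bar> \<longleftrightarrow> (\<exists>D \<in> {- mat 1 .. mat 1}. u + D *v v = 0)"
proof
  assume "\<bar>u\<bar> \<le> \<bar>v\<bar>"
  then have le: "\<bar>u $ i\<bar> \<le> \<bar>v $ i\<bar>" for i
    by (simp add: abs_le_abs_vec_iff)
  \<comment> \<open>Where \<open>v $ i = 0\<close>, also \<open>u $ i = 0\<close>, and the value \<open>0\<close> of the quotient is admissible.\<close>
  define D :: "real ^ 'n ^ 'n" where "D = (\<chi> i j. if i = j then - (u $ i / v $ i) else 0)"
  have "\<bar>u $ i / v $ i\<bar> \<le> 1" for i
    using le[of i] by (cases "v $ i = 0") auto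
  then have "- 1 \<le> D $ i $ i \<and> D $ i $ i \<le> 1" for i
    unfolding abs_le_iff by (simp add: D_def)
  then have D: "D \<in> {- mat 1 .. mat 1}"
    unfolding mem_unit_interval_iff by (simp add: D_def)
  have "u $ i + D $ i $ i * v $ i = 0" for i
    using le[of i] by (cases "v $ i = 0") (auto simp: D_def)
  then have "u + D *v v = 0"
    by (simp add: vec_eq_iff unit_interval_mult_vec_nth[OF D])
  with D show "\<exists>D \<in> {- mat 1 .. mat 1}. u + D *v v = 0" by blast
next
  assume "\<exists>D \<in> {- mat 1 .. mat 1}. u + D *v v = 0"
  then obtain D :: "real ^ 'n ^ 'n"
    where D: "D \<in> {- mat 1 .. mat 1}" and zero: "u + D *v v = 0" by blast
  have "\<bar>u $ i\<bar> \<le> \<bar>v $ i\<bar>" for i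
  proof -
    have "u $ i + D $ i $ i * v $ i = 0"
      using zero by (simp add: vec_eq_iff unit_interval_mult_vec_nth[OF D])
    then have "u $ i = - (D $ i $ i * v $ i)"
      by linarith
    then have "\<bar>u $ i\<bar> = \<bar>D $ i $ i\<bar> * \<bar>v $ i\<bar>"
      by (simp only: abs_minus_cancel abs_mult)
    moreover have "\<bar>D $ i $ i\<bar> \<le> 1"
      using D unfolding mem_unit_interval_iff abs_le_iff by (metis minus_le_iff)
    ultimately show ?thesis
      by (simp add: mult_left_le_one_le)
  qed
  then show "\<bar>u\<bar> \<le> \<bar>v\<bar>"
    by (simp add: abs_le_abs_vec_iff)
qed

lemma invertible_iff_transpose_kernel_trivial:
  fixes M :: "real ^ 'n ^ 'n"
  shows "invertible M \<longleftrightarrow> (\<forall>x. transpose M *v x = 0 \<longrightarrow> x = 0)"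
proof -
  have "invertible M \<longleftrightarrow> invertible (transpose M)"
    by (metis transpose_invertible transpose_transpose)
  then show ?thesis
    unfolding invertible_left_inverse[of "transpose M"] matrix_left_invertible_ker .
qed

lemma transpose_add_mult_unit_interval:
  fixes A B D :: "real ^ 'n ^ 'n"
  assumes "D \<in> {- mat 1 .. mat 1}"
  shows "transpose (A + B ** D) *v x = transpose A *v x + D *v (transpose B *v x)"
proof -
  have "transpose (A + B ** D) = transpose A + transpose (B ** D)"
    by (simp add: transpose_def vec_eq_iff)
  also have "transpose (B ** D) = D ** transpose B"
    by (simp add: matrix_transpose_mul transpose_unit_interval[OF assms])
  finally show ?thesis
    by (simp only: matrix_vector_mult_add_rdistrib matrix_vector_mul_assoc)
qed

theorem theorem4:
  fixes A B :: "real ^ 'n ^ 'n"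
  shows "(\<forall>D \<in> {- mat 1 .. mat 1}. invertible (A + B ** D)) \<longleftrightarrow>
    (\<forall>x :: real ^ 'n. \<bar>transpose A *v x\<bar> \<le> \<bar>transpose B *v x\<bar> \<longrightarrow> x = 0)"
proof -
  have "(\<forall>D \<in> {- mat 1 .. mat 1}. invertible (A + B ** D)) \<longleftrightarrow>
      (\<forall>D \<in> {- mat 1 .. mat 1}. \<forall>x. transpose A *v x + D *v (transpose B *v x) = 0 \<longrightarrow> x = 0)"
    by (rule ball_cong[OF refl])
      (simp only: invertible_iff_transpose_kernel_trivial transpose_add_mult_unit_interval)
  also have "\<dots> \<longleftrightarrow> (\<forall>x. (\<exists>D \<in> {- mat 1 .. mat 1}.
      transpose A *v x + D *v (transpose B *v x) = 0) \<longrightarrow> x = 0)"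
    by (iprover intro: ballI bexI elim: bexE dest: bspec)
  also have "\<dots> \<longleftrightarrow> (\<forall>x. \<bar>transpose A *v x\<bar> \<le> \<bar>transpose B *v x\<bar> \<longrightarrow> x = 0)"
    unfolding abs_le_iff_diagonal_annihilates ..
  finally show ?thesis .
qed

end
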